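(* Let $\lambda_0,\lambda_1>0$, and for $t\in\{0,1\}$ let $\bm{M}_t^\star$ be the optimal solution of $\min_{\bm{M}\succeq\bm{O}}P_{\lambda_t}(\bm{M})$. Then $$\left\|\bm{M}_1^\star-\frac{\lambda_0+\lambda_1}{2\lambda_1}\bm{M}_0^\star\right\|_F^2\le\left(\frac{\lambda_0-\lambda_1}{2\lambda_1}\left\|\bm{M}_0^\star\right\|_F\right)^2.$$
   Context: Let $\bm{x}_1,\dots,\bm{x}_n\in\mathbb{R}^d$ have labels $y_1,\dots,y_n$ in a discrete set, and let $\mathcal{T}=\{(i,j,l)\in\{1,\dots,n\}^3\mid y_i=y_j,\ i\neq j,\ y_i\neq y_l\}$. For $(i,j,l)\in\mathcal{T}$ put $\bm{H}_{ijl}=(\bm{x}_i-\bm{x}_l)(\bm{x}_i-\bm{x}_l)^\top-(\bm{x}_i-\bm{x}_j)(\bm{x}_i-\bm{x}_j)^\top$. $\langle \bm{A},\bm{B}\rangle=\mathrm{tr}(\bm{A}^\top\bm{B})$, $\|\bm{A}\|_F^2=\langle\bm{A},\bm{A}\rangle$, and $\bm{M}\succeq\bm{O}$ means that $\bm{M}\in\mathbb{R}^{d\times d}$ is (symmetric) positive semi-definite. The loss $\ell:\mathbb{R}\to\mathbb{R}$ is either the hinge loss $\ell(x)=\max\{0,1-x\}$ (parameter $\gamma=0$), or, for a parameter $\gamma>0$, the smoothed hinge loss: $\ell(x)=0$ for $x>1$, $\ell(x)=\frac{1}{2\gamma}(1-x)^2$ for $1-\gamma\le x\le1$, $\ell(x)=1-x-\frac{\gamma}{2}$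 for $x<1-\gamma$. For $\lambda>0$ the primal objective is $P_\lambda(\bm{M})=\sum_{(i,j,l)\in\mathcal{T}}\ell(\langle\bm{M},\bm{H}_{ijl}\rangle)+\frac{\lambda}{2}\|\bm{M}\|_F^2$; data and loss are the same for $\lambda_0$ and $\lambda_1$. *)

theory Defs
  imports "HOL-Analysis.Analysis"
begin

definition frob_inner :: "real^'d^'d \<Rightarrow> real^'d^'d \<Rightarrow> real" where
  "frob_inner A B = trace (transpose A ** B)"

definition frob_norm :: "real^'d^'d \<Rightarrow> real" where
  "frob_norm A = sqrt (frob_inner A A)"

text \<open>These are the library's inner product and norm on \<open>real^'d^'d\<close>.\<close>

lemma frob_inner_eq_inner: "frob_inner A B = A \<bullet> B"
proof -
  have "frob_inner A B = (\<Sum>i\<in>UNIV. \<Sum>k\<in>UNIV. A $ k $ i * B $ k $ i)"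
    by (simp add: frob_inner_def trace_def matrix_matrix_mult_def transpose_def)
  also have "\<dots> = (\<Sum>k\<in>UNIV. \<Sum>i\<in>UNIV. A $ k $ i * B $ k $ i)"
    by (rule sum.swap)
  finally show ?thesis
    by (simp add: inner_vec_def)
qed

lemma frob_norm_eq_norm: "frob_norm A = norm A"
  by (simp add: frob_norm_def frob_inner_eq_inner norm_eq_sqrt_inner)

definition psd :: "real^'d^'d \<Rightarrow> bool" where
  "psd M \<longleftrightarrow> transpose M = M \<and> (\<forall>v. 0 \<le> v \<bullet> (M *v v))"

text \<open>The matrix \<open>v v\<^sup>T\<close>; the index type \<open>1\<close> must be given explicitly,
  because \<open>columnvector\<close> and \<open>rowvector\<close> leave it open.\<close>

definition outer_square :: "real^'d \<Rightarrow> real^'d^'d" where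
  "outer_square v = (columnvector v :: real^1^'d) ** (rowvector v :: real^'d^1)"

lemma outer_square_nth: "outer_square v $ i $ j = v $ i * v $ j"
  by (simp add: outer_square_def matrix_matrix_mult_def columnvector_def rowvector_def)

text \<open>Data points and labels are functions on \<open>nat\<close>, of which only the values on
  \<open>{1..n}\<close> are used. Labels are only ever compared for equality, so any type will do.\<close>

definition triplets :: "nat \<Rightarrow> (nat \<Rightarrow> 'l) \<Rightarrow> (nat \<times> nat \<times> nat) set" where
  "triplets n y =
     {(i, j, l). i \<in> {1..n} \<and> j \<in> {1..n} \<and> l \<in> {1..n} \<and> y i = y j \<and> i \<noteq> j \<and> y i \<noteq> y l}"

lemma finite_triplets: "finite (triplets n y)"
  by (rule finite_subset[of _ "{1..n} \<times> {1..n} \<times> {1..n}"]) (auto simp: triplets_def)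

definition triplet_matrix :: "(nat \<Rightarrow> real^'d) \<Rightarrow> nat \<Rightarrow> nat \<Rightarrow> nat \<Rightarrow> real^'d^'d" where
  "triplet_matrix x i j l = outer_square (x i - x l) - outer_square (x i - x j)"

definition hinge_loss :: "real \<Rightarrow> real" where
  "hinge_loss x = max 0 (1 - x)"

text \<open>Meant for \<open>\<gamma> > 0\<close>; for \<open>\<gamma> = 0\<close> the role is taken by \<^const>\<open>hinge_loss\<close>.\<close>

definition smoothed_hinge_loss :: "real \<Rightarrow> real \<Rightarrow> real" where
  "smoothed_hinge_loss \<gamma> x =
     (if x > 1 then 0
      else if 1 - \<gamma> \<le> x then 1 / (2 * \<gamma>) * (1 - x)\<^sup>2
      else 1 - x - \<gamma> / 2)"

definition primal_objective ::
  "nat \<Rightarrow> (nat \<Rightarrow> real^'d) \<Rightarrow> (nat \<Rightarrow> 'l) \<Rightarrow> (real \<Rightarrow> real) \<Rightarrow> real \<Rightarrow> real^'d^'d \<Rightarrow> real" where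
  "primal_objective n x y loss lam M =
     (\<Sum>(i, j, l)\<in>triplets n y. loss (frob_inner M (triplet_matrix x i j l)))
       + lam / 2 * (frob_norm M)\<^sup>2"

end

theory Submission
  imports Defs
begin

text \<open>A minimiser \<open>M\<^sub>t\<close> of \<open>F + \<lambda>\<^sub>t/2 \<parallel>\<cdot>\<parallel>\<^sup>2\<close> over a convex set, with \<open>F\<close> convex, satisfies the
  variational inequality \<open>F M - F M\<^sub>t + \<lambda>\<^sub>t \<langle>M\<^sub>t, M - M\<^sub>t\<rangle> \<ge> 0\<close>. Adding the inequality for \<open>M\<^sub>0\<close>
  tested at \<open>M\<^sub>1\<close> to the one for \<open>M\<^sub>1\<close> tested at \<open>M\<^sub>0\<close> cancels \<open>F\<close>, and completing the square
  in \<open>M\<^sub>1\<close> gives the ball.\<close>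

text \<open>Averaging the supporting line at the intermediate point \<open>z\<close> over the two
  endpoints, with the weights that produce \<open>z\<close>, returns exactly \<open>f z\<close>.
  Convexity of a piecewise loss thus reduces to naming one slope per point.\<close>

lemma convex_on_if_subgradients:
  fixes f :: "real \<Rightarrow> real"
  assumes "\<And>x. \<exists>g. \<forall>y. f y \<ge> f x + g * (y - x)"
  shows "convex_on UNIV f"
proof (rule convex_onI)
  fix t x y :: real assume t: "0 < t" "t < 1"
  define z where "z = (1 - t) * x + t * y"
  obtain g where g: "\<And>y. f y \<ge> f z + g * (y - z)" using assms by blast
  have "(1 - t) * (f z + g * (x - z)) + t * (f z + g * (y - z)) \<le> (1 - t) * f x + t * f y"
    using g t by (intro add_mono mult_left_mono) auto
  moreover have "(1 - t) * (f z + g * (x - z)) + t * (f z + g * (y - z)) = f z"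
    by (simp add: z_def algebra_simps)
  ultimately show "f ((1 - t) *\<^sub>R x + t *\<^sub>R y) \<le> (1 - t) * f x + t * f y"
    by (simp add: z_def)
qed simp

lemma convex_on_hinge_loss: "convex_on UNIV hinge_loss"
proof (rule convex_on_if_subgradients)
  fix x
  show "\<exists>g. \<forall>y. hinge_loss y \<ge> hinge_loss x + g * (y - x)"
    \<comment> \<open>At the kink \<open>x = 1\<close> any slope in [-1, 0] would do; 0 is
      chosen.\<close>
    by (rule exI[of _ "if x < 1 then - 1 else 0"]) (auto simp: hinge_loss_def)
qed

text \<open>The smoothed hinge loss is the maximum of the affine functions
  \<open>a (1 - x) - \<gamma>/2 a\<^sup>2\<close> over \<open>a \<in> [0, 1]\<close>; the maximising \<open>a\<close> gives the subgradient \<open>-a\<close>.\<close>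

lemma smoothed_hinge_loss_ge:
  assumes "\<gamma> > 0" and "0 \<le> a" and "a \<le> 1"
  shows "a * (1 - x) - \<gamma> / 2 * a\<^sup>2 \<le> smoothed_hinge_loss \<gamma> x"
proof -
  consider "x > 1" | "1 - \<gamma> \<le> x" "x \<le> 1" | "x < 1 - \<gamma>" by linarith
  then show ?thesis
  proof cases
    case 1
    have "a * (1 - x) \<le> 0" using assms 1 by (intro mult_nonneg_nonpos) auto
    moreover have "0 \<le> \<gamma> / 2 * a\<^sup>2" using assms by simp
    ultimately show ?thesis using 1 by (simp add: smoothed_hinge_loss_def)
  next
    case 2
    \<comment> \<open>Completing the square in \<open>a\<close>; the gap vanishes at
      \<open>a = (1 - x) / \<gamma>\<close>.\<close>
    have "1 / (2 * \<gamma>) * (1 - x)\<^sup>2 - (a * (1 - x) - \<gamma> / 2 * a\<^sup>2) = (1 - x - \<gamma> * a)\<^sup>2 / (2 * \<gamma>)"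
      using assms by (simp add: field_simps power2_eq_square)
    also have "\<dots> \<ge> 0" using assms by simp
    finally show ?thesis using 2 by (simp add: smoothed_hinge_loss_def)
  next
    case 3
    \<comment> \<open>The gap factors through \<open>1 - a\<close>; the cofactor is nonnegative
      because \<open>\<gamma> / 2 * (1 + a) \<le> \<gamma> < 1 - x\<close>.\<close>
    have "\<gamma> / 2 * (1 + a) \<le> \<gamma> / 2 * 2" using assms by (intro mult_left_mono) auto
    then have "0 \<le> (1 - a) * ((1 - x) - \<gamma> / 2 * (1 + a))"
      using assms 3 by (intro mult_nonneg_nonneg) linarith+
    also have "\<dots> = 1 - x - \<gamma> / 2 - (a * (1 - x) - \<gamma> / 2 * a\<^sup>2)"
      by (simp add: field_simps power2_eq_square)
    finally show ?thesis using 3 assms by (simp add: smoothed_hinge_loss_def)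
  qed
qed

lemma smoothed_hinge_loss_attained:
  assumes "\<gamma> > 0"
  obtains a where "0 \<le> a" "a \<le> 1"
    and "smoothed_hinge_loss \<gamma> x = a * (1 - x) - \<gamma> / 2 * a\<^sup>2"
proof -
  consider "x > 1" | "1 - \<gamma> \<le> x" "x \<le> 1" | "x < 1 - \<gamma>" by linarith
  then show thesis
  proof cases
    case 1
    then show ?thesis by (intro that[of 0]) (auto simp: smoothed_hinge_loss_def)
  next
    case 2
    then show ?thesis using assms
      \<comment> \<open>The vertex of the concave quadratic in \<open>a\<close>, which lies in
        [0, 1] exactly in this case; the other two cases clip it to 0 and 1.\<close>
      by (intro that[of "(1 - x) / \<gamma>"])
        (auto simp: smoothed_hinge_loss_def field_simps power2_eq_square)
  next
    case 3
    then show ?thesis using assms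
      by (intro that[of 1]) (auto simp: smoothed_hinge_loss_def)
  qed
qed

lemma convex_on_smoothed_hinge_loss:
  assumes "\<gamma> > 0"
  shows "convex_on UNIV (smoothed_hinge_loss \<gamma>)"
proof (rule convex_on_if_subgradients)
  fix x
  obtain a where a: "0 \<le> a" "a \<le> 1"
    and eq: "smoothed_hinge_loss \<gamma> x = a * (1 - x) - \<gamma> / 2 * a\<^sup>2"
    using smoothed_hinge_loss_attained[OF assms] .
  have "smoothed_hinge_loss \<gamma> y \<ge> smoothed_hinge_loss \<gamma> x + (- a) * (y - x)" for y
    using smoothed_hinge_loss_ge[OF assms a, of y] unfolding eq by (simp add: algebra_simps)
  then show "\<exists>g. \<forall>y. smoothed_hinge_loss \<gamma> y \<ge> smoothed_hinge_loss \<gamma> x + g * (y - x)"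
    by blast
qed

lemma convex_on_comp_inner:
  fixes h :: "'a::real_inner" and f :: "real \<Rightarrow> real"
  assumes "convex_on UNIV f"
  shows "convex_on UNIV (\<lambda>M. f (M \<bullet> h))"
proof (rule convex_onI)
  fix t :: real and x y :: 'a assume "0 < t" "t < 1"
  then show "f (((1 - t) *\<^sub>R x + t *\<^sub>R y) \<bullet> h) \<le> (1 - t) * f (x \<bullet> h) + t * f (y \<bullet> h)"
    using convex_onD[OF assms, of t "x \<bullet> h" "y \<bullet> h"] by (simp add: inner_add_left)
qed simp

lemma convex_on_sum_fun:
  fixes f :: "'i \<Rightarrow> 'a::real_vector \<Rightarrow> real"
  assumes "finite I" and "convex S" and "\<And>i. i \<in> I \<Longrightarrow> convex_on S (f i)"
  shows "convex_on S (\<lambda>x. \<Sum>i\<in>I. f i x)"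
  using assms(1,3)
  by (induction I rule: finite_induct) (auto simp: convex_on_const assms(2) intro: convex_on_add)

lemma convex_psd: "convex (Collect psd)"
proof (rule convexI)
  fix A B :: "real^'d^'d" and u v :: real
  assume AB: "A \<in> Collect psd" "B \<in> Collect psd" and uv: "0 \<le> u" "0 \<le> v"
  have "A $ i $ j = A $ j $ i" "B $ i $ j = B $ j $ i" for i j
    using AB by (auto simp: psd_def transpose_def vec_eq_iff)
  then have "transpose (u *\<^sub>R A + v *\<^sub>R B) = u *\<^sub>R A + v *\<^sub>R B"
    by (simp add: transpose_def vec_eq_iff)
  moreover have "w \<bullet> ((u *\<^sub>R A + v *\<^sub>R B) *v w) = u * (w \<bullet> (A *v w)) + v * (w \<bullet> (B *v w))" for w
    by (simp add: matrix_vector_mult_add_rdistrib scaleR_matrix_vector_assoc[symmetric] inner_add_right)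
  ultimately show "u *\<^sub>R A + v *\<^sub>R B \<in> Collect psd"
    using AB uv by (simp add: psd_def)
qed

text \<open>Minimality of \<open>A\<close> is tested along the segment towards \<open>B\<close>,
  with \<open>F\<close> bounded there by its chord. Dividing by the step \<open>s\<close> and
  letting it tend to 0 leaves the first-order condition, with no derivative of \<open>F\<close>, so
  kinks are harmless.\<close>

lemma regularized_arg_min_variational:
  fixes F :: "'a::real_inner \<Rightarrow> real"
  assumes F: "convex_on S F"
    and min: "is_arg_min (\<lambda>M. F M + lam / 2 * (norm M)\<^sup>2) (\<lambda>M. M \<in> S) A"
    and B: "B \<in> S"
  shows "0 \<le> F B - F A + lam * (A \<bullet> (B - A))"
proof (rule tendsto_lowerbound)
  let ?g = "\<lambda>s. F B - F A + lam * (A \<bullet> (B - A)) + s * (lam / 2 * (norm (B - A))\<^sup>2)"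
  have "(?g \<longlongrightarrow> ?g 0) (at_right 0)" by (intro tendsto_intros)
  then show "(?g \<longlongrightarrow> F B - F A + lam * (A \<bullet> (B - A))) (at_right 0)" by simp
  have A: "A \<in> S" using min by (simp add: is_arg_min_linorder)
  have "0 \<le> ?g s" if s: "0 < s" "s < 1" for s
  proof -
    let ?C = "(1 - s) *\<^sub>R A + s *\<^sub>R B"
    have "?C \<in> S" using convex_on_imp_convex[OF F] A B s by (simp add: convexD)
    then have "F A + lam / 2 * (norm A)\<^sup>2 \<le> F ?C + lam / 2 * (norm ?C)\<^sup>2"
      using min by (simp add: is_arg_min_linorder)
    also have "F ?C \<le> (1 - s) * F A + s * F B"
      using F A B s by (intro convex_onD) auto
    also have "lam / 2 * (norm ?C)\<^sup>2 = lam / 2 * (norm A)\<^sup>2 + s * (lam * (A \<bullet> (B - A)))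
        + s * (s * (lam / 2 * (norm (B - A))\<^sup>2))"
    proof -
      have "?C = A + s *\<^sub>R (B - A)" by (simp add: algebra_simps)
      then have "(norm ?C)\<^sup>2 = (norm A)\<^sup>2 + 2 * s * (A \<bullet> (B - A)) + s\<^sup>2 * (norm (B - A))\<^sup>2"
        by (simp only: power2_norm_eq_inner)
          (simp add: inner_add_left inner_add_right inner_commute power2_eq_square)
      then show ?thesis by (simp only:) (simp add: field_simps power2_eq_square)
    qed
    \<comment> \<open>\<open>s * ?g s\<close> bounds from above the increase of the objective from
      \<open>A\<close> to \<open>?C\<close>.\<close>
    finally have "0 \<le> s * ?g s" by (simp add: algebra_simps)
    then show ?thesis using s by (simp add: zero_le_mult_iff)
  qed
  then show "\<forall>\<^sub>F s in at_right 0. 0 \<le> ?g s"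
    by (auto simp: eventually_at_right_field intro!: exI[of _ 1])
qed simp

lemma regularized_arg_min_ball:
  fixes F :: "'a::real_inner \<Rightarrow> real"
  assumes F: "convex_on S F" and lam: "lam\<^sub>1 > 0"
    and min0: "is_arg_min (\<lambda>M. F M + lam\<^sub>0 / 2 * (norm M)\<^sup>2) (\<lambda>M. M \<in> S) A"
    and min1: "is_arg_min (\<lambda>M. F M + lam\<^sub>1 / 2 * (norm M)\<^sup>2) (\<lambda>M. M \<in> S) B"
  shows "(norm (B - ((lam\<^sub>0 + lam\<^sub>1) / (2 * lam\<^sub>1)) *\<^sub>R A))\<^sup>2
           \<le> ((lam\<^sub>0 - lam\<^sub>1) / (2 * lam\<^sub>1) * norm A)\<^sup>2"
proof -
  have "A \<in> S" "B \<in> S" using min0 min1 by (simp_all add: is_arg_min_linorder)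
  then have "0 \<le> lam\<^sub>0 * (A \<bullet> (B - A)) + lam\<^sub>1 * (B \<bullet> (A - B))"
    using regularized_arg_min_variational[OF F min0, of B]
      regularized_arg_min_variational[OF F min1, of A] by linarith
  also have "\<dots> = lam\<^sub>1 * (((lam\<^sub>0 - lam\<^sub>1) / (2 * lam\<^sub>1) * norm A)\<^sup>2
      - (norm (B - ((lam\<^sub>0 + lam\<^sub>1) / (2 * lam\<^sub>1)) *\<^sub>R A))\<^sup>2)"
  proof -
    \<comment> \<open>In terms of the centre coefficient \<open>c\<close> the radius coefficient is
      \<open>c - 1\<close>, and eliminating \<open>lam\<^sub>0\<close> turns the claim into a
      division-free polynomial identity.\<close>
    define c where "c = (lam\<^sub>0 + lam\<^sub>1) / (2 * lam\<^sub>1)"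
    have l0: "lam\<^sub>0 = (2 * c - 1) * lam\<^sub>1" and d: "(lam\<^sub>0 - lam\<^sub>1) / (2 * lam\<^sub>1) = c - 1"
      using lam by (simp_all add: c_def field_simps)
    show ?thesis unfolding d c_def[symmetric] unfolding l0 power_mult_distrib power2_norm_eq_inner
      by (simp add: inner_diff_left inner_diff_right inner_commute algebra_simps power2_eq_square)
  qed
  finally show ?thesis using lam by (simp add: zero_le_mult_iff)
qed

theorem theorem3p7:
  fixes n :: nat
    and x :: "nat \<Rightarrow> real^'d"
    and y :: "nat \<Rightarrow> 'l"
    and loss :: "real \<Rightarrow> real"
    and lam\<^sub>0 lam\<^sub>1 :: real
    and M\<^sub>0 M\<^sub>1 :: "real^'d^'d"
  assumes "loss = hinge_loss \<or> (\<exists>\<gamma>>0. loss = smoothed_hinge_loss \<gamma>)"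
    and "lam\<^sub>0 > 0" and "lam\<^sub>1 > 0"
    and "is_arg_min (primal_objective n x y loss lam\<^sub>0) psd M\<^sub>0"
    and "is_arg_min (primal_objective n x y loss lam\<^sub>1) psd M\<^sub>1"
  shows "(frob_norm (M\<^sub>1 - ((lam\<^sub>0 + lam\<^sub>1) / (2 * lam\<^sub>1)) *\<^sub>R M\<^sub>0))\<^sup>2
           \<le> ((lam\<^sub>0 - lam\<^sub>1) / (2 * lam\<^sub>1) * frob_norm M\<^sub>0)\<^sup>2"
proof -
  define F where "F M = (\<Sum>t\<in>triplets n y. case t of (i, j, l) \<Rightarrow> loss (M \<bullet> triplet_matrix x i j l))"
    for M :: "real^'d^'d"
  have "convex_on UNIV loss"
    using assms(1) convex_on_hinge_loss convex_on_smoothed_hinge_loss by blast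
  then have "convex_on UNIV F"
    unfolding F_def[abs_def]
    by (intro convex_on_sum_fun finite_triplets) (auto intro: convex_on_comp_inner)
  \<comment> \<open>Each summand of \<open>F\<close> is a convex loss of a linear form, so
    \<open>F\<close> is convex everywhere; restricting it to the cone records that segments between
    feasible matrices stay feasible.\<close>
  then have F: "convex_on (Collect psd) F"
    by (rule convex_on_subset) (auto simp: convex_psd)
  have obj: "primal_objective n x y loss lam = (\<lambda>M. F M + lam / 2 * (norm M)\<^sup>2)" for lam
    by (simp add: fun_eq_iff primal_objective_def F_def frob_inner_eq_inner frob_norm_eq_norm)
  show ?thesis
    unfolding frob_norm_eq_norm
    using regularized_arg_min_ball[OF F assms(3)] assms(4,5) by (simp add: obj)
qed

end
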